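(* Let $n\ge 1$, $N=2^n$, let $z\in\{0,1\}^n$ and $\ell(x)=z\cdot x\bmod 2$, and let $\mathcal{U}$ be an arbitrary unitary operator on $(\mathbb{C}^2)^{\otimes n}$. Write $|\psi\rangle=\mathcal{U}|0^n\rangle=\sum_{x=0}^{N-1}a_x|x\rangle$, $\delta=\rho^{\mathcal{U}}=|\psi\rangle\langle\psi|$, and $\rho^{\mathcal{O}_\ell}=\mathcal{O}_\ell\,\rho^{\mathcal{U}}\,\mathcal{O}_\ell^\dagger$. Let $S=\{x:\ell(x)=0\}$ and $T=\{x:\ell(x)=1\}$. Then the coherence fraction of the oracle $\mathcal{O}_\ell$ with respect to the state $\rho^{\mathcal{U}}$ is $$C_{\mathcal{F}}(\rho^{\mathcal{O}_\ell})=P_{\mathrm{succ}}^{G}(\delta)-\frac{4}{N}\,\Re\Big(\sum_{s\in S,\;t\in T}a_s a_t^*\Big),$$ where $\Re$ denotes the real part and $a^*$ the complex conjugate of $a$.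
   Context: Basis states $|x\rangle$, $0\le x\le N-1$, of $(\mathbb{C}^2)^{\otimes n}$ are identified with bit strings $x\in\{0,1\}^n$ via binary representation; $|0^n\rangle$ is the all-zero basis state. For the secret string $z\in\{0,1\}^n$, $z\cdot x=\sum_{k=1}^n z_kx_k$. The oracle $\mathcal{O}_\ell$ is the unitary on $(\mathbb{C}^2)^{\otimes n}$ with $\mathcal{O}_\ell|x\rangle=(-1)^{\ell(x)}|x\rangle$. $H$ is the single-qubit Hadamard gate, so $H^{\otimes n}|x\rangle=\frac{1}{\sqrt N}\sum_{y=0}^{N-1}(-1)^{x\cdot y}|y\rangle$. Generalized Bernstein-Vazirani (GBV) algorithm: start from $|0^n\rangle$, apply an arbitrary unitary $\mathcal{U}$ to get the initial state $|\psi\rangle=\mathcal{U}|0^n\rangle$, apply $\mathcal{O}_\ell$, apply $H^{\otimes n}$, and measure in the computational basis (the ancilla qubit is omitted since its state is unchanged by the oracle). The algorithm succeeds if the outcome is $z$; its success probability is $$P_{\mathrm{succ}}^{G}(\delta)=\left|\langle z|H^{\otimes n}\mathcal{O}_\ell\,\mathcal{U}|0^n\rangle\right|^2,\qquad \delta=|\psi\rangle\langle\psi|.$$ State coherence fraction: for a density operator $\rho$ on $(\mathbb{C}^2)^{\otimes n}$, $C_{\mathcal F}(\rho):=\langle\eta|\rho|\eta\rangle$, where $|\eta\rangle=\frac{1}{\sqrt N}\sum_{x=0}^{N-1}|x\rangle$. Operator coherence fraction: the coherence fraction of a unitary $U$ with respect to a pure state $\rho=|\phi\rangle\langle\phi|$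 is $C_{\mathcal F}(\rho^{U}):=C_{\mathcal F}(U\rho U^\dagger)$. *)

theory Defs
  imports "Jordan_Normal_Form.Schur_Decomposition" Complex_Main
begin

text \<open>
  The state space of \<open>n\<close> qubits is the space of complex vectors of dimension \<open>2 ^ n\<close>. Basis
  states and bit strings of length \<open>n\<close> are both represented by numbers below \<open>2 ^ n\<close>.
\<close>

abbreviation ket :: "nat \<Rightarrow> nat \<Rightarrow> complex vec" where
  "ket n x \<equiv> unit_vec (2 ^ n) x"

text \<open>The scalar product \<open>\<bullet>c\<close> conjugates its second argument, a bra-ket its first.\<close>

definition braket :: "complex vec \<Rightarrow> complex vec \<Rightarrow> complex" where
  "braket u v = v \<bullet>c u"

definition ketbra :: "complex vec \<Rightarrow> complex vec \<Rightarrow> complex mat" where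
  "ketbra u v = mat (dim_vec u) (dim_vec v) (\<lambda>(i, j). u $ i * cnj (v $ j))"

definition unitary_op :: "nat \<Rightarrow> complex mat \<Rightarrow> bool" where
  "unitary_op n U \<longleftrightarrow> U \<in> carrier_mat (2 ^ n) (2 ^ n) \<and>
     mat_adjoint U * U = 1\<^sub>m (2 ^ n) \<and> U * mat_adjoint U = 1\<^sub>m (2 ^ n)"

text \<open>
  \<open>str_bit n x k\<close>, for \<open>1 \<le> k \<le> n\<close>, is the \<open>k\<close>-th symbol of the bit string \<open>x\<close>, counted from
  the most significant bit; the first qubit is thus the leftmost tensor factor in \<open>kronecker\<close>.
\<close>

definition str_bit :: "nat \<Rightarrow> nat \<Rightarrow> nat \<Rightarrow> nat" where
  "str_bit n x k = x div 2 ^ (n - k) mod 2"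

definition str_dot :: "nat \<Rightarrow> nat \<Rightarrow> nat \<Rightarrow> nat" where
  "str_dot n z x = (\<Sum>k = 1..n. str_bit n z k * str_bit n x k)"

definition parity_fun :: "nat \<Rightarrow> nat \<Rightarrow> nat \<Rightarrow> nat" where
  "parity_fun n z x = str_dot n z x mod 2"

definition phase_oracle :: "nat \<Rightarrow> (nat \<Rightarrow> nat) \<Rightarrow> complex mat" where
  "phase_oracle n l = mat_diag (2 ^ n) (\<lambda>x. (-1) ^ l x)"

definition kronecker :: "complex mat \<Rightarrow> complex mat \<Rightarrow> complex mat" where
  "kronecker A B = mat (dim_row A * dim_row B) (dim_col A * dim_col B)
     (\<lambda>(i, j). A $$ (i div dim_row B, j div dim_col B) * B $$ (i mod dim_row B, j mod dim_col B))"

primrec tensor_power :: "complex mat \<Rightarrow> nat \<Rightarrow> complex mat" where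
  "tensor_power A 0 = 1\<^sub>m 1"
| "tensor_power A (Suc n) = kronecker A (tensor_power A n)"

definition hadamard :: "complex mat" where
  "hadamard = complex_of_real (1 / sqrt 2) \<cdot>\<^sub>m mat_of_rows_list 2 [[1, 1], [1, -1]]"

definition gbv_success_prob :: "nat \<Rightarrow> nat \<Rightarrow> complex mat \<Rightarrow> real" where
  "gbv_success_prob n z U = (cmod (braket (ket n z)
     (tensor_power hadamard n *\<^sub>v (phase_oracle n (parity_fun n z) *\<^sub>v (U *\<^sub>v ket n 0)))))\<^sup>2"

definition superpos :: "nat \<Rightarrow> (nat \<Rightarrow> complex) \<Rightarrow> complex vec" where
  "superpos n a = finsum_vec TYPE(complex) (2 ^ n) (\<lambda>x. a x \<cdot>\<^sub>v ket n x) {0..<2 ^ n}"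

definition eta :: "nat \<Rightarrow> complex vec" where
  "eta n = superpos n (\<lambda>x. complex_of_real (1 / sqrt (2 ^ n)))"

definition coherence_fraction :: "nat \<Rightarrow> complex mat \<Rightarrow> complex" where
  "coherence_fraction n \<rho> = braket (eta n) (\<rho> *\<^sub>v eta n)"

definition operator_coherence_fraction :: "nat \<Rightarrow> complex mat \<Rightarrow> complex mat \<Rightarrow> complex" where
  "operator_coherence_fraction n U \<rho> = coherence_fraction n (U * \<rho> * mat_adjoint U)"

end

theory Submission
  imports Defs
begin

text \<open>
  Both quantities are squared moduli of sums of the amplitudes. Row \<open>z\<close> of the Hadamard
  transform carries the same signs as the oracle, so they cancel and the success probability is
  \<open>\<bar>A + B\<bar>\<^sup>2 / N\<close>, with \<open>A\<close> and \<open>B\<close> the sums of the amplitudes over \<open>S\<close> and \<open>T\<close>. In the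
  coherence fraction the signs of the oracle survive and give \<open>\<bar>A - B\<bar>\<^sup>2 / N\<close>. By polarization
  the two differ by \<open>4 Re (A B\<^sup>*) / N\<close>.
\<close>

lemma dim_superpos [simp]: "dim_vec (superpos n a) = 2 ^ n"
proof -
  have "superpos n a \<in> carrier_vec (2 ^ n)"
    unfolding superpos_def by (rule finsum_vec_closed) auto
  then show ?thesis by simp
qed

lemma index_superpos [simp]:
  assumes "i < 2 ^ n"
  shows "superpos n a $ i = a i"
proof -
  have "superpos n a $ i = (\<Sum>x\<in>{0..<2 ^ n}. (a x \<cdot>\<^sub>v ket n x) $ i)"
    unfolding superpos_def by (rule index_finsum_vec) (use assms in auto)
  also have "\<dots> = (\<Sum>x\<in>{0..<2 ^ n}. if x = i then a x else 0)"
    using assms by (intro sum.cong) auto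
  also have "\<dots> = a i"
    using assms by simp
  finally show ?thesis .
qed

lemma braket_superpos: "braket (superpos n a) (superpos n b) = (\<Sum>x<2 ^ n. cnj (a x) * b x)"
  by (auto simp: braket_def scalar_prod_def lessThan_atLeast0 mult.commute intro!: sum.cong)

lemma phase_oracle_superpos:
  "phase_oracle n l *\<^sub>v superpos n a = superpos n (\<lambda>x. (-1) ^ l x * a x)"
proof (rule eq_vecI)
  fix i assume "i < dim_vec (superpos n (\<lambda>x. (-1) ^ l x * a x))"
  then have i: "i < 2 ^ n" by simp
  then show "(phase_oracle n l *\<^sub>v superpos n a) $ i = superpos n (\<lambda>x. (-1) ^ l x * a x) $ i"
    by (simp add: phase_oracle_def mat_diag_def scalar_prod_def if_distrib [of "\<lambda>x. x * _"]
        cong: if_cong)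
qed (simp add: phase_oracle_def mat_diag_def)

text \<open>The oracle is diagonal with real entries \<plusminus>1, so transposing and conjugating
  change nothing.\<close>

lemma mat_adjoint_phase_oracle: "mat_adjoint (phase_oracle n l) = phase_oracle n l"
  by (rule eq_matI)
    (auto simp: mat_adjoint_def phase_oracle_def mat_diag_def mat_of_rows_def)

lemma phase_oracle_conj_ketbra:
  "phase_oracle n l * ketbra (superpos n a) (superpos n b) * mat_adjoint (phase_oracle n l)
    = ketbra (superpos n (\<lambda>x. (-1) ^ l x * a x)) (superpos n (\<lambda>x. (-1) ^ l x * b x))"
proof -
  have carr: "ketbra (superpos n a) (superpos n b) \<in> carrier_mat (2 ^ n) (2 ^ n)"
    by (simp add: ketbra_def)
  show ?thesis
    unfolding mat_adjoint_phase_oracle unfolding phase_oracle_def mat_diag_mult_left [OF carr]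
    by (subst mat_diag_mult_right [of _ "2 ^ n"]) (auto simp: ketbra_def)
qed

text \<open>For a pure state the coherence fraction is the squared modulus of the overlap with
  \<open>eta n\<close>, and that overlap is, up to conjugation, the sum of the amplitudes divided by
  the square root of \<open>2 ^ n\<close>.\<close>

lemma coherence_fraction_ketbra:
  "coherence_fraction n (ketbra (superpos n a) (superpos n a))
    = complex_of_real ((cmod (\<Sum>x<2 ^ n. a x))\<^sup>2 / 2 ^ n)"
proof -
  define c where "c = complex_of_real (1 / sqrt (2 ^ n))"
  have cc: "c * c = complex_of_real (1 / 2 ^ n)"
    unfolding c_def of_real_mult [symmetric] by simp
  have eta: "eta n = superpos n (\<lambda>_. c)"
    by (simp add: eta_def c_def)
  \<comment> \<open>The rank-one operator rescales its own vector by the overlap with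
    \<open>eta n\<close>, here \<open>cnj (\<Sum>x<2 ^ n. a x) * c\<close>.\<close>
  have "ketbra (superpos n a) (superpos n a) *\<^sub>v eta n
    = superpos n (\<lambda>i. a i * cnj (\<Sum>x<2 ^ n. a x) * c)"
    by (rule eq_vecI)
      (auto simp: ketbra_def eta scalar_prod_def lessThan_atLeast0 sum_distrib_left
        sum_distrib_right mult.assoc intro!: sum.cong)
  moreover have "cnj c = c"
    by (simp add: c_def)
  ultimately have "coherence_fraction n (ketbra (superpos n a) (superpos n a))
    = (\<Sum>i<2 ^ n. c * (a i * cnj (\<Sum>x<2 ^ n. a x) * c))"
    unfolding coherence_fraction_def eta by (simp only: braket_superpos)
  also have "\<dots> = (c * c) * ((\<Sum>x<2 ^ n. a x) * cnj (\<Sum>x<2 ^ n. a x))"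
    by (simp only: sum_distrib_right sum_distrib_left mult_ac)
  also have "\<dots> = complex_of_real ((cmod (\<Sum>x<2 ^ n. a x))\<^sup>2 / 2 ^ n)"
    unfolding cc complex_norm_square [symmetric] by simp
  finally show ?thesis .
qed

text \<open>Splitting off the most significant bit matches the recursion of
  \<open>tensor_power\<close>, whose new factor stands on the left and is indexed by that
  bit.\<close>

lemma str_dot_Suc:
  "str_dot (Suc n) x y
    = x div 2 ^ n mod 2 * (y div 2 ^ n mod 2) + str_dot n (x mod 2 ^ n) (y mod 2 ^ n)"
proof -
  have bit: "str_bit (Suc n) w (Suc k) = str_bit n (w mod 2 ^ n) k" if "k \<in> {1..n}" for w k
  proof -
    \<comment> \<open>Since \<open>k \<ge> 1\<close>, the remaining reduction modulo
      \<open>2 ^ k\<close> preserves the lowest bit, the only one that \<open>str_bit\<close>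
      reads.\<close>
    have "w mod 2 ^ n div 2 ^ (n - k) = w div 2 ^ (n - k) mod 2 ^ k"
      using that drop_bit_take_bit [of "n - k" n w]
      by (simp add: drop_bit_eq_div take_bit_eq_mod)
    then show ?thesis
      using that by (simp add: str_bit_def mod_mod_cancel)
  qed
  have "str_dot (Suc n) x y = str_bit (Suc n) x 1 * str_bit (Suc n) y 1
    + (\<Sum>k = Suc 1..Suc n. str_bit (Suc n) x k * str_bit (Suc n) y k)"
    unfolding str_dot_def by (rule sum.atLeast_Suc_atMost) simp
  also have "(\<Sum>k = Suc 1..Suc n. str_bit (Suc n) x k * str_bit (Suc n) y k)
    = (\<Sum>k = 1..n. str_bit (Suc n) x (Suc k) * str_bit (Suc n) y (Suc k))"
    by (rule sum.shift_bounds_cl_Suc_ivl)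
  also have "\<dots> = str_dot n (x mod 2 ^ n) (y mod 2 ^ n)"
    unfolding str_dot_def using bit by (intro sum.cong) simp_all
  finally show ?thesis
    by (simp add: str_bit_def)
qed

lemma tensor_power_hadamard_carrier:
  "tensor_power hadamard n \<in> carrier_mat (2 ^ n) (2 ^ n)"
  by (induction n) (auto simp: kronecker_def hadamard_def mat_of_rows_list_def)

lemma index_hadamard:
  assumes "i < 2" "j < 2"
  shows "hadamard $$ (i, j) = complex_of_real (1 / sqrt 2) * (-1) ^ (i * j)"
proof -
  have "i = 0 \<or> i = 1" "j = 0 \<or> j = 1" using assms by auto
  then show ?thesis
    by (auto simp: hadamard_def mat_of_rows_list_def)
qed

text \<open>Entries of a Kronecker product multiply, so the exponents of the signs add up bit by bit
  to the dot product, and the normalizing factors multiply likewise.\<close>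

lemma index_tensor_power_hadamard:
  assumes "i < 2 ^ n" "j < 2 ^ n"
  shows "tensor_power hadamard n $$ (i, j)
    = complex_of_real (1 / sqrt (2 ^ n)) * (-1) ^ str_dot n i j"
  using assms
proof (induction n arbitrary: i j)
  case 0
  then show ?case by (simp add: str_dot_def)
next
  case (Suc n)
  \<comment> \<open>Both quotients are single bits, so they index the leading Hadamard factor and
    the \<open>mod 2\<close> in \<open>str_dot_Suc\<close> leaves them unchanged.\<close>
  have div: "i div 2 ^ n < 2" "j div 2 ^ n < 2"
    using Suc.prems by (simp_all add: less_mult_imp_div_less)
  have dim: "dim_row hadamard = 2" "dim_col hadamard = 2"
    by (simp_all add: hadamard_def mat_of_rows_list_def)
  have "tensor_power hadamard (Suc n) $$ (i, j)
    = hadamard $$ (i div 2 ^ n, j div 2 ^ n) * tensor_power hadamard n $$ (i mod 2 ^ n, j mod 2 ^ n)"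
    using Suc.prems tensor_power_hadamard_carrier [of n] by (simp add: kronecker_def dim)
  also have "\<dots> = complex_of_real (1 / sqrt (2 ^ Suc n)) * (-1) ^ str_dot (Suc n) i j"
    using div by (simp add: Suc.IH index_hadamard str_dot_Suc power_add real_sqrt_mult)
  finally show ?case .
qed

lemma gbv_success_prob_superpos:
  assumes z: "z < 2 ^ n" and U: "U *\<^sub>v ket n 0 = superpos n a"
  shows "gbv_success_prob n z U = (cmod (\<Sum>x<2 ^ n. a x))\<^sup>2 / 2 ^ n"
proof -
  let ?s = "\<lambda>x. (-1) ^ parity_fun n z x :: complex"
  define c where "c = complex_of_real (1 / sqrt (2 ^ n))"
  define w where "w = tensor_power hadamard n *\<^sub>v superpos n (\<lambda>x. ?s x * a x)"
  have dim: "dim_row (tensor_power hadamard n) = 2 ^ n" "dim_col (tensor_power hadamard n) = 2 ^ n"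
    using tensor_power_hadamard_carrier [of n] by auto
  have w: "w \<in> carrier_vec (2 ^ n)"
    unfolding w_def carrier_vec_def by (simp add: dim)
  have "braket (ket n z) w = w $ z"
    using z w by (simp add: braket_def scalar_prod_def if_distrib [of cnj]
        if_distrib [of "\<lambda>x. _ * x"] cong: if_cong)
  also have "\<dots> = (\<Sum>x<2 ^ n. c * (-1) ^ str_dot n z x * (?s x * a x))"
    using z by (auto simp: w_def scalar_prod_def dim lessThan_atLeast0 index_tensor_power_hadamard c_def
        intro!: sum.cong)
  also have "\<dots> = c * (\<Sum>x<2 ^ n. a x)"
  proof -
    \<comment> \<open>The exponents are a number and its remainder modulo 2, whose sum is
      even.\<close>
    have "(-1) ^ str_dot n z x * ?s x = 1" for x
      unfolding parity_fun_def power_add [symmetric]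
      by (rule neg_one_even_power) simp
    then have "c * (-1) ^ str_dot n z x * (?s x * a x) = c * a x" for x
      by (metis mult.assoc mult_1)
    then show ?thesis
      by (simp only: sum_distrib_left)
  qed
  finally show ?thesis
    unfolding gbv_success_prob_def U phase_oracle_superpos w_def [symmetric]
    by (simp add: c_def norm_mult norm_divide power_divide power_mult_distrib)
qed

text \<open>Expanding either square gives the squared moduli of \<open>A\<close> and
  \<open>B\<close> and a cross term \<open>2 * Re (A * cnj B)\<close>, whose sign is the only
  difference.\<close>

lemma cmod_diff_sq_polarization:
  "(cmod (A - B))\<^sup>2 = (cmod (A + B))\<^sup>2 - 4 * Re (A * cnj B)"
  unfolding cmod_power2 by (simp add: power2_eq_square algebra_simps)

theorem theorem3:
  fixes n z :: nat
    and U \<delta> :: "complex mat"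
    and \<psi> :: "complex vec"
    and a :: "nat \<Rightarrow> complex"
    and S T :: "nat set"
  assumes "n \<ge> 1"
    and "z < 2 ^ n"
    and "unitary_op n U"
    and "\<psi> = U *\<^sub>v ket n 0"
    and "\<psi> = superpos n a"
    and "\<delta> = ketbra \<psi> \<psi>"
    and "S = {x. x < 2 ^ n \<and> parity_fun n z x = 0}"
    and "T = {x. x < 2 ^ n \<and> parity_fun n z x = 1}"
  shows "operator_coherence_fraction n (phase_oracle n (parity_fun n z)) \<delta> =
    complex_of_real (gbv_success_prob n z U
      - 4 / 2 ^ n * Re (\<Sum>s\<in>S. \<Sum>t\<in>T. a s * cnj (a t)))"
proof -
  define A B where "A = (\<Sum>s\<in>S. a s)" and "B = (\<Sum>t\<in>T. a t)"
  \<comment> \<open>A remainder modulo 2 is either 0 or 1, so \<open>S\<close> and \<open>T\<close>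
    partition the basis states.\<close>
  have split: "{..<2 ^ n} = S \<union> T" "S \<inter> T = {}" "finite S" "finite T"
    using assms(7,8) by (auto simp: parity_fun_def)
  have sum: "(\<Sum>x<2 ^ n. a x) = A + B"
    unfolding A_def B_def split(1) using split by (intro sum.union_disjoint)
  have "(\<Sum>x<2 ^ n. (-1) ^ parity_fun n z x * a x)
    = (\<Sum>x\<in>S. (-1) ^ parity_fun n z x * a x) + (\<Sum>x\<in>T. (-1) ^ parity_fun n z x * a x)"
    unfolding split(1) using split by (intro sum.union_disjoint)
  \<comment> \<open>The oracle sign is constant on each class: 1 on \<open>S\<close> and -1 on
    \<open>T\<close>.\<close>
  also have "\<dots> = A - B"
    using assms(7,8) by (simp add: A_def B_def sum_negf)
  finally have signed_sum: "(\<Sum>x<2 ^ n. (-1) ^ parity_fun n z x * a x) = A - B" .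
  have "operator_coherence_fraction n (phase_oracle n (parity_fun n z)) \<delta>
    = complex_of_real ((cmod (A - B))\<^sup>2 / 2 ^ n)"
    unfolding operator_coherence_fraction_def assms(6) assms(5) phase_oracle_conj_ketbra
      coherence_fraction_ketbra signed_sum ..
  moreover have "gbv_success_prob n z U = (cmod (A + B))\<^sup>2 / 2 ^ n"
    using gbv_success_prob_superpos [of z n U a] assms(2,4,5) sum by metis
  moreover have "(\<Sum>s\<in>S. \<Sum>t\<in>T. a s * cnj (a t)) = A * cnj B"
    by (simp add: A_def B_def sum_product)
  ultimately show ?thesis
    by (simp add: cmod_diff_sq_polarization diff_divide_distrib)
qed

end
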